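(* Let $x$ be a complex number and $n$ a positive integer such that all quantities below are defined. Then \[ \sum_{k=0}^n\binom{2n-k}{n}\binom{x+k}{k}kH_{k}^{\langle2\rangle}(x)=\frac{x+1}{8}\binom{x+2n+1}{n-1} \Big\{4H_{2n+1}^{\langle2\rangle}(x) -\big[H_n(\tfrac{x}{2})-H_n(\tfrac{x+1}{2})\big]\big[H_n(\tfrac{x}{2})-H_n(\tfrac{x+1}{2})+\tfrac{4}{n}\big]+\tfrac{4}{(x+1)^2}\Big\}. \]
   Context: For a complex $y$ and an integer $k\ge 0$, $\binom{y}{k}=\frac{y(y-1)\cdots(y-k+1)}{k!}$. For complex $x$, integer $n\ge 0$ and positive integer $\ell$: $H_0^{\langle\ell\rangle}(x)=0$, $H_n^{\langle\ell\rangle}(x)=\sum_{k=1}^n\frac{1}{(x+k)^\ell}$, and $H_n(x)=H_n^{\langle1\rangle}(x)$. *)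

theory Defs
  imports Complex_Main
begin

definition gharm :: "nat \<Rightarrow> nat \<Rightarrow> complex \<Rightarrow> complex" where
  "gharm l n x = (\<Sum>k=1..n. 1 / (x + of_nat k) ^ l)"

end

theory Submission
  imports Defs "HOL-Computational_Algebra.Formal_Power_Series"
begin

text \<open>
  After division by \<open>(x + 1) \<cdot> binom(x + 2n + 1, n - 1)\<close> the weights
  \<open>binom(2n - k, n) \<cdot> binom(x + k, k) \<cdot> k\<close> sum to 1, and their increment from \<open>n\<close> to \<open>n + 1\<close> is
  a difference in \<open>k\<close> (a WZ pair).  Summation by parts therefore replaces the harmonic
  numbers by the simple factors \<open>1/(x + k)^2\<close> and expresses the increment of the whole sum through
  \<open>\<Sum>\<^sub>j binom(2n - j, n) \<cdot> binom(x + j, j) / (x + j + 1)\<close>.  The latter equals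
  \<open>binom(x + 2n + 1, n)\<close> times the alternating sum of \<open>1/(x + i)\<close> over \<open>1 \<le> i \<le> 2n + 1\<close>, because
  the increment in \<open>n\<close> of its normalised weights is divisible by \<open>x + j + 1\<close>, so that only
  Vandermonde convolutions remain.
\<close>

section \<open>Convolutions of Vandermonde type\<close>

text \<open>By upper negation, \<open>(c + of_nat k) gchoose k\<close> is the coefficient of t^k in
  (1 - t)^(-c-1). The claim compares coefficients in the product of two such series, which is
  Vandermonde's identity with negated upper arguments.\<close>

lemma gbinomial_convolution:
  fixes a b :: "'a::field_char_0"
  shows "(\<Sum>j\<le>m. ((b + of_nat (m - j)) gchoose (m - j)) * ((a + of_nat j) gchoose j))
       = (a + b + of_nat m + 1) gchoose m"
proof -
  have neg: "(c + of_nat k) gchoose k = (-1) ^ k * ((-(c + 1)) gchoose k)" for c :: 'a and k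
    using gbinomial_negated_upper[of "c + of_nat k" k] by simp
  have "(\<Sum>j\<le>m. ((b + of_nat (m - j)) gchoose (m - j)) * ((a + of_nat j) gchoose j))
      = (\<Sum>j\<le>m. (-1) ^ m * (((-(a + 1)) gchoose j) * ((-(b + 1)) gchoose (m - j))))"
  proof (rule sum.cong)
    fix j assume "j \<in> {..m}"
    then have "(-1 :: 'a) ^ m = (-1) ^ (m - j) * (-1) ^ j"
      by (simp flip: power_add)
    then show "((b + of_nat (m - j)) gchoose (m - j)) * ((a + of_nat j) gchoose j)
        = (-1) ^ m * (((-(a + 1)) gchoose j) * ((-(b + 1)) gchoose (m - j)))"
      unfolding neg by (simp only: mult_ac)
  qed simp
  also have "\<dots> = (-1) ^ m * ((-(a + 1) + -(b + 1)) gchoose m)"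
    using gbinomial_Vandermonde[of "-(a + 1)" "-(b + 1)" m]
    by (simp only: sum_distrib_left[symmetric] atMost_atLeast0)
  also have "\<dots> = (a + b + of_nat m + 1) gchoose m"
  proof -
    have "-(a + 1) + -(b + 1) = -(a + b + 1 + 1)" "a + b + of_nat m + 1 = a + b + 1 + of_nat m"
      by (simp_all add: algebra_simps)
    then show ?thesis by (simp only: neg)
  qed
  finally show ?thesis .
qed

text \<open>The case \<open>b = of_nat n\<close> of the preceding convolution, after binomial
  symmetry has turned the lower index \<open>n\<close> into \<open>m - j\<close>.\<close>

lemma choose_gbinomial_convolution:
  fixes x :: "'a::field_char_0"
  shows "(\<Sum>j\<le>m. of_nat ((n + m - j) choose n) * ((x + of_nat j) gchoose j))
       = (x + of_nat n + of_nat m + 1) gchoose m"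
proof -
  have "of_nat ((n + m - j) choose n) = ((of_nat n + of_nat (m - j) :: 'a) gchoose (m - j))"
    if "j \<le> m" for j
  proof -
    have "(n + m - j) choose n = (n + (m - j)) choose (m - j)"
      using that binomial_symmetric[of n "n + (m - j)"] by simp
    then show ?thesis
      by (simp add: binomial_gbinomial del: of_nat_diff)
  qed
  then show ?thesis
    using gbinomial_convolution[of "of_nat n :: 'a" m x] by (simp del: of_nat_diff)
qed

lemma central_choose_gbinomial_convolution:
  fixes x :: "'a::field_char_0"
  shows "(\<Sum>j\<le>n. of_nat ((2 * n - j) choose n) * ((x + of_nat j) gchoose j))
       = (x + 2 * of_nat n + 1) gchoose n"
proof -
  have "n + n = 2 * n" "x + of_nat n + of_nat n + 1 = x + 2 * of_nat n + 1" by simp_all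
  then show ?thesis using choose_gbinomial_convolution[of n n x] by (simp only:)
qed

lemma gbinomial_add_self_Suc:
  fixes x :: "'a::field_char_0"
  shows "of_nat (Suc k) * ((x + of_nat (Suc k)) gchoose Suc k)
       = (x + of_nat k + 1) * ((x + of_nat k) gchoose k)"
  using gbinomial_absorption[of k "x + of_nat (Suc k)"] by (simp add: algebra_simps)

text \<open>The factor \<open>j\<close> is absorbed into the second binomial, which shifts
  \<open>x\<close> to \<open>x + 1\<close> and lowers the summation range by one. With
  \<open>m = n - 1\<close> this evaluates the total weight by which the main sum is
  normalised.\<close>

lemma sum_choose_gbinomial_times_index:
  fixes x :: "'a::field_char_0"
  shows "(\<Sum>j\<le>Suc m. of_nat ((n + Suc m - j) choose n) * ((x + of_nat j) gchoose j) * of_nat j)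
       = (x + 1) * ((x + of_nat n + of_nat m + 2) gchoose m)"
proof -
  \<comment> \<open>As functions of \<open>j\<close>, both sides obey the same first-order recursion
    with ratio \<open>(x + j + 2) / (j + 1)\<close>; the induction step clears its denominator and
    cancels it at the end.\<close>
  have shift: "((x + of_nat (Suc j)) gchoose Suc j) * of_nat (Suc j)
      = (x + 1) * ((x + 1 + of_nat j) gchoose j)" for j
  proof (induction j)
    case 0
    then show ?case by simp
  next
    case (Suc j)
    have 1: "of_nat (Suc (Suc j)) * ((x + of_nat (Suc (Suc j))) gchoose Suc (Suc j))
        = (x + of_nat (Suc j) + 1) * ((x + of_nat (Suc j)) gchoose Suc j)"
      by (rule gbinomial_add_self_Suc)
    have 2: "of_nat (Suc j) * ((x + 1 + of_nat (Suc j)) gchoose Suc j)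
        = (x + 1 + of_nat j + 1) * ((x + 1 + of_nat j) gchoose j)"
      by (rule gbinomial_add_self_Suc)
    have "of_nat (Suc j) * (((x + of_nat (Suc (Suc j))) gchoose Suc (Suc j)) * of_nat (Suc (Suc j)))
        = (x + of_nat (Suc j) + 1) * (((x + of_nat (Suc j)) gchoose Suc j) * of_nat (Suc j))"
      using 1 by (simp only: mult_ac)
    also have "\<dots> = (x + 1) * ((x + 1 + of_nat j + 1) * ((x + 1 + of_nat j) gchoose j))"
      unfolding Suc by (simp add: algebra_simps)
    also have "\<dots> = of_nat (Suc j) * ((x + 1) * ((x + 1 + of_nat (Suc j)) gchoose Suc j))"
      unfolding 2[symmetric] by (simp only: mult_ac)
    finally show ?case
      by (simp only: mult_left_cancel of_nat_neq_0 not_False_eq_True)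
  qed
  have "(\<Sum>j\<le>Suc m. of_nat ((n + Suc m - j) choose n) * ((x + of_nat j) gchoose j) * of_nat j)
      = (\<Sum>j\<le>m. of_nat ((n + m - j) choose n) *
          (((x + of_nat (Suc j)) gchoose Suc j) * of_nat (Suc j)))"
    by (subst sum.atMost_Suc_shift) (simp add: mult.assoc del: of_nat_Suc)
  also have "\<dots> = (x + 1) * (\<Sum>j\<le>m. of_nat ((n + m - j) choose n) * ((x + 1 + of_nat j) gchoose j))"
    unfolding shift sum_distrib_left by (intro sum.cong) (simp_all add: mult_ac)
  also have "\<dots> = (x + 1) * ((x + of_nat n + of_nat m + 2) gchoose m)"
    unfolding choose_gbinomial_convolution by (simp add: algebra_simps)
  finally show ?thesis .
qed

section \<open>Contiguity relations for the binomial weights\<close>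

lemma choose_step_relations:
  fixes n i :: nat
  shows "Suc n * ((n + i) choose Suc n) = i * ((n + i) choose n)"
    and "Suc n * ((n + i + 1) choose Suc n) = (n + i + 1) * ((n + i) choose n)"
    and "Suc n * Suc (Suc n) * ((n + i + 2) choose Suc (Suc n))
       = (n + i + 1) * (n + i + 2) * ((n + i) choose n)"
proof -
  show "Suc n * ((n + i) choose Suc n) = i * ((n + i) choose n)"
    using binomial_absorb_comp[of "n + i" n] binomial_absorption[of n "n + i"] by simp
  show 2: "Suc n * ((n + i + 1) choose Suc n) = (n + i + 1) * ((n + i) choose n)"
    using Suc_times_binomial_eq[of "n + i" n] by (simp add: mult.commute)
  have "Suc (Suc n) * ((n + i + 2) choose Suc (Suc n)) = (n + i + 2) * ((n + i + 1) choose Suc n)"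
    using Suc_times_binomial_eq[of "n + i + 1" "Suc n"] by (simp add: mult.commute)
  then have "Suc n * Suc (Suc n) * ((n + i + 2) choose Suc (Suc n))
      = (n + i + 2) * (Suc n * ((n + i + 1) choose Suc n))"
    by (metis mult.assoc mult.left_commute)
  then show "Suc n * Suc (Suc n) * ((n + i + 2) choose Suc (Suc n))
       = (n + i + 1) * (n + i + 2) * ((n + i) choose n)"
    unfolding 2 by (simp only: mult_ac)
qed

text \<open>Every weight becomes a polynomial multiple of the single \<open>w\<close>, so relations
  between weights reduce to polynomial identities. The lower index \<open>n - 1\<close> serves as
  reference because \<open>w\<close> is still 1 at \<open>j = n + 1\<close>, where the weight for
  \<open>n\<close> vanishes but the weight for \<open>n + 1\<close> does not.\<close>

lemma central_choose_relations:
  fixes n j :: nat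
  assumes "n \<ge> 1" "j \<le> n + 1"
  defines "w \<equiv> of_nat ((2 * n - j) choose (n - 1)) :: complex"
  shows "of_nat n * of_nat ((2 * n - j) choose n) = (of_nat n + 1 - of_nat j) * w"
    and "of_nat n * of_nat ((2 * n + 1 - j) choose n) = (2 * of_nat n + 1 - of_nat j) * w"
    and "of_nat n * (of_nat n + 1) * of_nat ((2 * n + 2 - j) choose (n + 1))
       = (2 * of_nat n + 1 - of_nat j) * (2 * of_nat n + 2 - of_nat j) * w"
proof -
  obtain m where m: "n = Suc m" using assms(1) by (cases n) auto
  define i where "i = n + 1 - j"
  have idx: "2 * n - j = m + i" "2 * n + 1 - j = m + i + 1" "2 * n + 2 - j = m + i + 2"
    using assms(2) unfolding i_def m by auto
  have i: "of_nat i = (of_nat n + 1 - of_nat j :: complex)"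
    using assms(2) unfolding i_def by (simp add: of_nat_diff)
  have mi: "of_nat (m + i + 1) = (2 * of_nat n + 1 - of_nat j :: complex)"
      "of_nat (m + i + 2) = (2 * of_nat n + 2 - of_nat j :: complex)"
      "of_nat (Suc n) = (of_nat n + 1 :: complex)"
    by (simp_all add: i m)
  note rel = choose_step_relations[of m i, THEN arg_cong[where f = "of_nat :: nat \<Rightarrow> complex"],
      unfolded of_nat_mult]
  have w: "w = of_nat ((m + i) choose m)" unfolding w_def idx(1) using m by simp
  show "of_nat n * of_nat ((2 * n - j) choose n) = (of_nat n + 1 - of_nat j) * w"
    using rel(1) unfolding m[symmetric] idx(1) w i .
  show "of_nat n * of_nat ((2 * n + 1 - j) choose n) = (2 * of_nat n + 1 - of_nat j) * w"
    using rel(2) unfolding m[symmetric] mi idx(2) w .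
  show "of_nat n * (of_nat n + 1) * of_nat ((2 * n + 2 - j) choose (n + 1))
       = (2 * of_nat n + 1 - of_nat j) * (2 * of_nat n + 2 - of_nat j) * w"
    using rel(3) unfolding m[symmetric] mi idx(3) w by (simp only: Suc_eq_plus1)
qed

text \<open>With \<open>y = x + 2 * of_nat n + 1\<close>, the cases \<open>k = n\<close> and
  \<open>k = n - 1\<close> describe how the prefactors of the two closed forms grow from
  \<open>n\<close> to \<open>n + 1\<close>.\<close>

lemma gbinomial_ratio_step:
  fixes y :: "'a::field_char_0"
  shows "of_nat (Suc k) * (y + 1 - of_nat k) * ((y + 2) gchoose Suc k)
       = (y + 1) * (y + 2) * (y gchoose k)"
proof -
  have "of_nat (Suc k) * ((y + 2) gchoose Suc k) = (y + 2) * ((y + 1) gchoose k)"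
    using gbinomial_absorption[of k "y + 2"] by (simp add: add.commute)
  moreover have "(y + 1 - of_nat k) * ((y + 1) gchoose k) = (y + 1) * (y gchoose k)"
    using gbinomial_absorb_comp[of "y + 1" k] by simp
  ultimately show ?thesis by (metis mult.assoc mult.left_commute)
qed

section \<open>The reciprocal sum and the alternating harmonic sum\<close>

text \<open>This is twice the sum of (-1)^i / (x + i) over 2 <= i <= 2n + 1, so
  \<open>1 / (x + 1) - harm_gap n x / 2\<close> is the alternating sum started at i = 1.\<close>

definition harm_gap :: "nat \<Rightarrow> complex \<Rightarrow> complex" where
  "harm_gap n x = gharm 1 n (x / 2) - gharm 1 n ((x + 1) / 2)"

lemma harm_gap_Suc:
  assumes "x + 2 * of_nat n + 2 \<noteq> 0" "x + 2 * of_nat n + 3 \<noteq> 0"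
  shows "harm_gap (Suc n) x
       = harm_gap n x + 2 / ((x + 2 * of_nat n + 2) * (x + 2 * of_nat n + 3))"
proof -
  have mid: "x / 2 + of_nat (Suc n) = (x + 2 * of_nat n + 2) / 2"
    "(x + 1) / 2 + of_nat (Suc n) = (x + 2 * of_nat n + 3) / 2"
    by (simp_all add: field_simps)
  have "gharm 1 (Suc n) y = gharm 1 n y + 1 / (y + of_nat (Suc n))" for y
    unfolding gharm_def by simp
  then have "harm_gap (Suc n) x
      = harm_gap n x + (2 / (x + 2 * of_nat n + 2) - 2 / (x + 2 * of_nat n + 3))"
    unfolding harm_gap_def mid by (simp only: mid) simp
  also have "2 / (x + 2 * of_nat n + 2) - 2 / (x + 2 * of_nat n + 3)
      = 2 / ((x + 2 * of_nat n + 2) * (x + 2 * of_nat n + 3))"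
    using assms by (simp add: field_simps)
  finally show ?thesis .
qed

definition recip_sum :: "nat \<Rightarrow> complex \<Rightarrow> complex" where
  "recip_sum n x = (\<Sum>j\<le>n. of_nat ((2 * n - j) choose n) * ((x + of_nat j) gchoose j)
     / (x + of_nat j + 1))"

text \<open>The multipliers are those of \<open>gbinomial_ratio_step\<close> at
  \<open>k = n\<close>. After division by the prefactor, the recurrence therefore gives a plain
  increment of \<open>- 1 / (?u * ?v)\<close>.\<close>

lemma recip_sum_Suc:
  assumes n: "n \<ge> 1" and nz: "\<And>k. 1 \<le> k \<Longrightarrow> k \<le> 2 * n + 3 \<Longrightarrow> x + of_nat k \<noteq> 0"
  shows "(of_nat n + 1) * (x + of_nat n + 2) * recip_sum (Suc n) x
       = (x + 2 * of_nat n + 2) * (x + 2 * of_nat n + 3) * recip_sum n x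
         - ((x + 2 * of_nat n + 1) gchoose n)"
proof -
  define c where "c j = ((x + of_nat j) gchoose j)" for j
  define w where "w j = (of_nat ((2 * n - j) choose (n - 1)) :: complex)" for j
  define W where "W j = (of_nat ((2 * n - j) choose n) :: complex)" for j
  define W' where "W' j = (of_nat ((2 * n + 2 - j) choose (n + 1)) :: complex)" for j
  let ?N = "of_nat n :: complex" and ?P = "(x + 2 * of_nat n + 1) gchoose n"
  let ?u = "x + 2 * of_nat n + 2" and ?v = "x + 2 * of_nat n + 3"
  have N: "?N \<noteq> 0" "?N + 1 \<noteq> 0"
    using n of_nat_neq_0[of n, where 'a = complex] by (simp_all add: add.commute)
  \<comment> \<open>This lets the sum for \<open>n\<close> run over the range of the sum for
    \<open>n + 1\<close>. At \<open>n = 0\<close> truncated subtraction would make the value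
    1.\<close>
  have W_top: "W (Suc n) = 0" using n unfolding W_def by simp
  have termwise: "(?N + 1) * (x + ?N + 2) * (W' j * c j / (x + of_nat j + 1))
      = ?u * ?v * (W j * c j / (x + of_nat j + 1))
        - (x + ?N + 2) * (W j * c j) + (?N + 1) * (w j * c j)" if "j \<le> n + 1" for j
  proof -
    let ?J = "of_nat j :: complex"
    have d: "x + ?J + 1 \<noteq> 0" using nz[of "Suc j"] that n by (simp add: add_ac)
    note rel = central_choose_relations[OF n that, folded w_def W_def W'_def]
    have 1: "W j = (?N + 1 - ?J) * w j / ?N"
      using rel(1) N by (simp add: nonzero_eq_divide_eq mult_ac)
    have 3: "W' j = (2 * ?N + 1 - ?J) * (2 * ?N + 2 - ?J) * w j / (?N * (?N + 1))"
      using rel(3) N by (simp add: nonzero_eq_divide_eq mult_ac)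
    \<comment> \<open>At \<open>?J = -(x + 1)\<close> the factors \<open>2 * ?N + 1 - ?J\<close> and
      \<open>2 * ?N + 2 - ?J\<close> become \<open>?u\<close> and \<open>?v\<close>, so the
      difference of the two products is divisible by \<open>x + ?J + 1\<close>. The two terms of the
      quotient yield the weights \<open>w\<close> and \<open>W\<close>, free of
      denominators.\<close>
    have key: "(x + ?N + 2) * ((2 * ?N + 1 - ?J) * (2 * ?N + 2 - ?J))
        = ?u * ?v * (?N + 1 - ?J)
          + (x + ?J + 1) * (?N * (?N + 1) - (x + ?N + 2) * (?N + 1 - ?J))"
      by algebra
    have "(?N + 1) * (x + ?N + 2) * (W' j * c j / (x + ?J + 1))
        = (x + ?N + 2) * ((2 * ?N + 1 - ?J) * (2 * ?N + 2 - ?J)) * (w j * c j / (?N * (x + ?J + 1)))"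
      unfolding 3 using N d by (simp add: divide_simps)
    also have "\<dots> = ?u * ?v * (W j * c j / (x + ?J + 1))
        - (x + ?N + 2) * (W j * c j) + (?N + 1) * (w j * c j)"
      unfolding key 1 using N d by (simp add: divide_simps) (simp add: algebra_simps)
    finally show ?thesis .
  qed
  have "(?N + 1) * (x + ?N + 2) * recip_sum (Suc n) x
      = (\<Sum>j\<le>Suc n. (?N + 1) * (x + ?N + 2) * (W' j * c j / (x + of_nat j + 1)))"
  proof -
    have "2 * (n + 1) = 2 * n + 2" by simp
    then show ?thesis
      unfolding recip_sum_def W'_def c_def sum_distrib_left by (simp only: Suc_eq_plus1)
  qed
  also have "\<dots> = (\<Sum>j\<le>Suc n. ?u * ?v * (W j * c j / (x + of_nat j + 1))
        - (x + ?N + 2) * (W j * c j) + (?N + 1) * (w j * c j))"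
    by (rule sum.cong) (use termwise in auto)
  also have "\<dots> = ?u * ?v * (\<Sum>j\<le>Suc n. W j * c j / (x + of_nat j + 1))
        - (x + ?N + 2) * (\<Sum>j\<le>Suc n. W j * c j) + (?N + 1) * (\<Sum>j\<le>Suc n. w j * c j)"
    by (simp only: sum.distrib sum_subtractf sum_distrib_left)
  also have "(\<Sum>j\<le>Suc n. W j * c j / (x + of_nat j + 1)) = recip_sum n x"
    using W_top unfolding recip_sum_def W_def c_def by simp
  also have "(\<Sum>j\<le>Suc n. W j * c j) = ?P"
    using W_top central_choose_gbinomial_convolution[of n x] unfolding W_def c_def by simp
  also have "(\<Sum>j\<le>Suc n. w j * c j) = (x + 2 * ?N + 1) gchoose (Suc n)"
  proof -
    have "n - 1 + Suc n = 2 * n" "of_nat (n - 1) + of_nat (Suc n) = 2 * ?N"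
      using n by (simp_all add: of_nat_diff)
    then show ?thesis
      using choose_gbinomial_convolution[of "n - 1" "Suc n" x] n
      unfolding w_def c_def by (simp only: add.assoc)
  qed
  \<comment> \<open>The two convolution values almost cancel:
    \<open>-(x + ?N + 2) + (x + ?N + 1)\<close> leaves just \<open>- ?P\<close>.\<close>
  also have "(?N + 1) * ((x + 2 * ?N + 1) gchoose (Suc n)) = (x + ?N + 1) * ?P"
    using gbinomial_mult_1[of "x + 2 * ?N + 1" n] by (simp add: algebra_simps)
  finally show ?thesis by (simp add: algebra_simps)
qed

text \<open>Induction on the normalised recurrence: its increment \<open>- 1 / (?u * ?v)\<close> is
  minus half the increment of \<open>harm_gap\<close>.\<close>

lemma recip_sum_closed_form:
  assumes "n \<ge> 1" and "\<And>k. 1 \<le> k \<Longrightarrow> k \<le> 2 * n + 1 \<Longrightarrow> x + of_nat k \<noteq> 0"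
  shows "recip_sum n x = ((x + 2 * of_nat n + 1) gchoose n) * (1 / (x + 1) - harm_gap n x / 2)"
  using assms
proof (induction n rule: nat_induct_at_least)
  case base
  have nz: "x + 1 \<noteq> 0" "x + 2 \<noteq> 0" "x + 3 \<noteq> 0"
    using base[of 1] base[of 2] base[of 3] by simp_all
  have gap: "harm_gap 1 x = 2 / ((x + 2) * (x + 3))"
    using harm_gap_Suc[of x 0] nz by (simp add: harm_gap_def gharm_def)
  have "recip_sum 1 x = 2 / (x + 1) + (x + 1) / (x + 2)"
    unfolding recip_sum_def by (simp add: add.assoc)
  also have "\<dots> = (x + 3) * (1 / (x + 1) - 1 / ((x + 2) * (x + 3)))"
    using nz by (simp add: divide_simps) algebra
  finally show ?case unfolding gap by (simp add: add.assoc)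
next
  case (Suc n)
  let ?N = "of_nat n :: complex" and ?P = "(x + 2 * of_nat n + 1) gchoose n"
  let ?u = "x + 2 * of_nat n + 2" and ?v = "x + 2 * of_nat n + 3"
  let ?Q = "1 / (x + 1) - harm_gap n x / 2"
  have nz: "?u \<noteq> 0" "?v \<noteq> 0" "x + ?N + 2 \<noteq> 0"
    using Suc.prems[of "2 * n + 2"] Suc.prems[of "2 * n + 3"] Suc.prems[of "n + 2"]
    by (simp_all add: add_ac)
  have N: "?N + 1 \<noteq> 0"
    using of_nat_neq_0[of n, where 'a = complex] by (simp add: add.commute)
  have IH: "recip_sum n x = ?P * ?Q" using Suc by simp
  have step: "(?N + 1) * (x + ?N + 2) * recip_sum (Suc n) x = ?u * ?v * recip_sum n x - ?P"
    by (rule recip_sum_Suc) (use Suc in auto)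
  have ratio: "(?N + 1) * (x + ?N + 2) * ((x + 2 * of_nat (Suc n) + 1) gchoose Suc n) = ?u * ?v * ?P"
    using gbinomial_ratio_step[of n "x + 2 * ?N + 1"] by (simp add: algebra_simps)
  have gap: "1 / (x + 1) - harm_gap (Suc n) x / 2 = ?Q - 1 / (?u * ?v)"
    using harm_gap_Suc[OF nz(1,2)] by (simp add: add_divide_distrib)
  have "(?N + 1) * (x + ?N + 2) * recip_sum (Suc n) x = ?u * ?v * ?P * (?Q - 1 / (?u * ?v))"
    unfolding step IH using nz by (simp add: right_diff_distrib)
  also have "\<dots> = (?N + 1) * (x + ?N + 2) * (((x + 2 * of_nat (Suc n) + 1) gchoose Suc n)
      * (1 / (x + 1) - harm_gap (Suc n) x / 2))"
    unfolding gap ratio[symmetric] by (simp only: mult.assoc)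
  finally show ?case using N nz by simp
qed

section \<open>Recurrence and closed form for the harmonic sum\<close>

lemma sum_by_parts:
  fixes g h :: "nat \<Rightarrow> 'a::comm_ring"
  shows "(\<Sum>k\<le>m. (g (Suc k) - g k) * h k)
       = g (Suc m) * h m - g 0 * h 0 - (\<Sum>k<m. g (Suc k) * (h (Suc k) - h k))"
  by (induction m) (simp_all add: algebra_simps)

definition weighted_sum :: "nat \<Rightarrow> complex \<Rightarrow> complex" where
  "weighted_sum n x = (\<Sum>k\<le>n. of_nat ((2 * n - k) choose n) * ((x + of_nat k) gchoose k)
     * of_nat k * gharm 2 k x)"

text \<open>The factors \<open>of_nat n * (x + of_nat n + 3)\<close> and
  \<open>(x + 2 * of_nat n + 2) * (x + 2 * of_nat n + 3)\<close> are those of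
  \<open>gbinomial_ratio_step\<close> at \<open>k = n - 1\<close>; the common
  \<open>of_nat n + 1\<close> clears a denominator. With these multipliers the weight difference
  telescopes in \<open>k\<close>.\<close>

lemma weighted_sum_Suc:
  assumes n: "n \<ge> 1" and nz: "\<And>k. 1 \<le> k \<Longrightarrow> k \<le> n + 1 \<Longrightarrow> x + of_nat k \<noteq> 0"
  shows "of_nat n * (of_nat n + 1) * (x + of_nat n + 3) * weighted_sum (Suc n) x
       = (of_nat n + 1) * (x + 2 * of_nat n + 2) * (x + 2 * of_nat n + 3) * weighted_sum n x
         + of_nat n * (x + 1) * ((x + 2 * of_nat n + 1) gchoose (n - 1))
         + (x + 3 * of_nat n + 3)
           * (((x + 2 * of_nat n + 1) gchoose n) - (x + 1) * recip_sum n x)"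
proof -
  define c where "c j = ((x + of_nat j) gchoose j)" for j
  define h where "h k = gharm 2 k x" for k
  define w where "w j = (of_nat ((2 * n - j) choose (n - 1)) :: complex)" for j
  define W where "W j = (of_nat ((2 * n - j) choose n) :: complex)" for j
  define W' where "W' j = (of_nat ((2 * n + 2 - j) choose (n + 1)) :: complex)" for j
  let ?N = "of_nat n :: complex"
  let ?u = "x + 2 * of_nat n + 2" and ?v = "x + 2 * of_nat n + 3"
  define g where "g k = - (of_nat k - 1) * (?N * of_nat k + (?N + 1) * (x + 3))
      * of_nat ((2 * n + 1 - k) choose n) * (of_nat k * c k)" for k
  have N: "?N \<noteq> 0" using n by simp
  have W_top: "W (Suc n) = 0" using n unfolding W_def by simp
  have g_Suc: "g (Suc k) = - of_nat k * (?N * (of_nat k + 1) + (?N + 1) * (x + 3))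
      * W k * ((x + of_nat k + 1) * c k)" for k
    unfolding g_def c_def gbinomial_add_self_Suc W_def by (simp add: add.commute)
  \<comment> \<open>\<open>g\<close> comes from Gosper's algorithm applied to the left-hand side.\<close>
  have telescope: "?N * (?N + 1) * (x + ?N + 3) * (W' k * c k * of_nat k)
      - (?N + 1) * ?u * ?v * (W k * c k * of_nat k) = g (Suc k) - g k" if "k \<le> n + 1" for k
  proof -
    let ?K = "of_nat k :: complex"
    note rel = central_choose_relations[OF n that, folded w_def W_def W'_def]
    \<comment> \<open>Once all weights are expressed through \<open>w k\<close>, the common factor
      \<open>w k * c k * ?K\<close> splits off and this polynomial identity is what remains of the
      telescoping relation.\<close>
    have poly: "?N * (x + ?N + 3) * ((2 * ?N + 1 - ?K) * (2 * ?N + 2 - ?K))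
          - (?N + 1) * ?u * ?v * (?N + 1 - ?K)
        = - (?N * (?K + 1) + (?N + 1) * (x + 3)) * (?N + 1 - ?K) * (x + ?K + 1)
          + (?K - 1) * (?N * ?K + (?N + 1) * (x + 3)) * (2 * ?N + 1 - ?K)"
      by algebra
    \<comment> \<open>The next three facts only regroup factors and hence are stated for arbitrary
      coefficients.\<close>
    have factor: "(a * (p * w k) - b * (q * w k)) * (c k * ?K) = (a * p - b * q) * (w k * c k * ?K)"
      for a b p q by (simp add: algebra_simps)
    have split: "(- a * q * d + b * p) * (w k * c k * ?K)
        = - ?K * a * (q * w k) * (d * c k) + b * (p * w k) * (?K * c k)"
      for a b p q d by (simp add: algebra_simps)
    have collect: "- ?K * a * (?N * W k) * (d * c k) + b * e * (?N * z) * (?K * c k)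
        = ?N * (- ?K * a * W k * (d * c k) - - b * e * z * (?K * c k))"
      for a b d e z by (simp add: algebra_simps)
    have "?N * (?N * (?N + 1) * (x + ?N + 3) * (W' k * c k * ?K)
          - (?N + 1) * ?u * ?v * (W k * c k * ?K))
        = (?N * (x + ?N + 3) * (?N * (?N + 1) * W' k) - (?N + 1) * ?u * ?v * (?N * W k)) * (c k * ?K)"
      by (simp add: algebra_simps)
    also have "\<dots> = (?N * (x + ?N + 3) * ((2 * ?N + 1 - ?K) * (2 * ?N + 2 - ?K))
          - (?N + 1) * ?u * ?v * (?N + 1 - ?K)) * (w k * c k * ?K)"
      unfolding rel by (rule factor)
    also have "\<dots> = - ?K * (?N * (?K + 1) + (?N + 1) * (x + 3)) * ((?N + 1 - ?K) * w k)
            * ((x + ?K + 1) * c k)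
          + (?K - 1) * (?N * ?K + (?N + 1) * (x + 3)) * ((2 * ?N + 1 - ?K) * w k) * (?K * c k)"
      unfolding poly by (rule split)
    also have "\<dots> = ?N * (g (Suc k) - g k)"
      unfolding rel(1,2)[symmetric] g_Suc unfolding g_def
      by (rule collect)
    finally show ?thesis using N by simp
  qed
  have h_Suc: "h (Suc k) - h k = 1 / (x + of_nat k + 1)\<^sup>2" for k
    unfolding h_def gharm_def by (simp add: add_ac)
  have remainder: "- (g (Suc k) * (h (Suc k) - h k))
      = ?N * (W k * c k * of_nat k) + (x + 3 * ?N + 3) * (W k * c k)
        - (x + 3 * ?N + 3) * (x + 1) * (W k * c k / (x + of_nat k + 1))" if "k \<le> n" for k
  proof -
    let ?K = "of_nat k :: complex"
    define d where "d = x + ?K + 1"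
    have d: "d \<noteq> 0" using nz[of "Suc k"] that unfolding d_def by (simp add: add_ac)
    \<comment> \<open>One factor \<open>d\<close> of \<open>g (Suc k)\<close> cancels against
      \<open>1 / d\<^sup>2\<close>. Dividing the rest by \<open>d\<close> with remainder separates
      two convolution sums from a multiple of \<open>recip_sum\<close>.\<close>
    have K: "?K * (?N * (?K + 1) + (?N + 1) * (x + 3))
        = d * (?N * ?K + (x + 3 * ?N + 3)) - (x + 3 * ?N + 3) * (x + 1)"
      unfolding d_def by algebra
    have "- (g (Suc k) * (h (Suc k) - h k))
        = ?K * (?N * (?K + 1) + (?N + 1) * (x + 3)) * (W k * c k / d)"
      unfolding g_Suc h_Suc d_def[symmetric] using d by (simp add: field_simps power2_eq_square)
    also have "\<dots> = ?N * (W k * c k * ?K) + (x + 3 * ?N + 3) * (W k * c k)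
        - (x + 3 * ?N + 3) * (x + 1) * (W k * c k / d)"
      unfolding K using d by (simp add: divide_simps) (simp add: algebra_simps)
    finally show ?thesis unfolding d_def .
  qed
  have S': "weighted_sum (Suc n) x = (\<Sum>k\<le>Suc n. W' k * c k * of_nat k * h k)"
    unfolding weighted_sum_def W'_def c_def h_def by simp
  have S: "weighted_sum n x = (\<Sum>k\<le>Suc n. W k * c k * of_nat k * h k)"
    using W_top unfolding weighted_sum_def W_def c_def h_def by simp
  have "?N * (?N + 1) * (x + ?N + 3) * weighted_sum (Suc n) x
        - (?N + 1) * ?u * ?v * weighted_sum n x
      = (\<Sum>k\<le>Suc n. (?N * (?N + 1) * (x + ?N + 3) * (W' k * c k * of_nat k)
          - (?N + 1) * ?u * ?v * (W k * c k * of_nat k)) * h k)"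
    unfolding S S' sum_distrib_left sum_subtractf[symmetric] left_diff_distrib
    by (simp only: mult.assoc)
  also have "\<dots> = (\<Sum>k\<le>Suc n. (g (Suc k) - g k) * h k)"
    by (rule sum.cong) (use telescope in auto)
  also have "\<dots> = g (Suc (Suc n)) * h (Suc n) - g 0 * h 0
      - (\<Sum>k<Suc n. g (Suc k) * (h (Suc k) - h k))"
    by (rule sum_by_parts)
  \<comment> \<open>Both boundary terms vanish: \<open>g (Suc (Suc n))\<close> contains
    \<open>W (Suc n) = 0\<close>, and \<open>g 0\<close> contains the factor
    \<open>of_nat 0\<close>.\<close>
  also have "\<dots> = (\<Sum>k\<le>n. - (g (Suc k) * (h (Suc k) - h k)))"
    unfolding g_Suc[of "Suc n"] W_top by (simp add: g_def lessThan_Suc_atMost sum_negf)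
  also have "\<dots> = (\<Sum>k\<le>n. ?N * (W k * c k * of_nat k) + (x + 3 * ?N + 3) * (W k * c k)
        - (x + 3 * ?N + 3) * (x + 1) * (W k * c k / (x + of_nat k + 1)))"
    by (rule sum.cong) (use remainder in auto)
  also have "\<dots> = ?N * (\<Sum>k\<le>n. W k * c k * of_nat k) + (x + 3 * ?N + 3) * (\<Sum>k\<le>n. W k * c k)
        - (x + 3 * ?N + 3) * (x + 1) * (\<Sum>k\<le>n. W k * c k / (x + of_nat k + 1))"
    by (simp only: sum.distrib sum_subtractf sum_distrib_left)
  also have "(\<Sum>k\<le>n. W k * c k / (x + of_nat k + 1)) = recip_sum n x"
    unfolding recip_sum_def W_def c_def by simp
  also have "(\<Sum>k\<le>n. W k * c k) = (x + 2 * ?N + 1) gchoose n"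
    unfolding W_def c_def by (rule central_choose_gbinomial_convolution)
  also have "(\<Sum>k\<le>n. W k * c k * of_nat k) = (x + 1) * ((x + 2 * ?N + 1) gchoose (n - 1))"
  proof -
    have "Suc (n - 1) = n" "n + n = 2 * n" "x + ?N + of_nat (n - 1) + 2 = x + 2 * ?N + 1"
      using n by (simp_all add: of_nat_diff)
    then show ?thesis
      using sum_choose_gbinomial_times_index[of n "n - 1" x] unfolding W_def c_def
      by (simp only:)
  qed
  finally show ?thesis by (simp add: algebra_simps)
qed

text \<open>Induction again: the closed form of \<open>recip_sum\<close> makes the increment of the
  normalised sum affine in \<open>harm_gap\<close>, and the bracket has the same increment because
  its terms quadratic in reciprocals combine.\<close>

lemma weighted_sum_closed_form:
  assumes "n \<ge> 1" and "\<And>k. 1 \<le> k \<Longrightarrow> k \<le> 2 * n + 1 \<Longrightarrow> x + of_nat k \<noteq> 0"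
  shows "weighted_sum n x = (x + 1) / 8 * ((x + 2 * of_nat n + 1) gchoose (n - 1)) *
           (4 * gharm 2 (2 * n + 1) x - harm_gap n x * (harm_gap n x + 4 / of_nat n)
            + 4 / (x + 1) ^ 2)"
  using assms
proof (induction n rule: nat_induct_at_least)
  case base
  have nz: "x + 1 \<noteq> 0" "x + 2 \<noteq> 0" "x + 3 \<noteq> 0"
    using base[of 1] base[of 2] base[of 3] by simp_all
  have gap: "harm_gap 1 x = 2 / ((x + 2) * (x + 3))"
    using harm_gap_Suc[of x 0] nz by (simp add: harm_gap_def gharm_def)
  have harm: "gharm 2 (2 * 1 + 1) x = 1 / (x + 1)\<^sup>2 + 1 / (x + 2)\<^sup>2 + 1 / (x + 3)\<^sup>2"
    unfolding gharm_def by (simp add: numeral_3_eq_3 add_ac)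
  have "weighted_sum 1 x = (x + 1) / (x + 1)\<^sup>2"
    unfolding weighted_sum_def gharm_def by simp
  also have "\<dots> = (x + 1) / 8 * (4 * (1 / (x + 1)\<^sup>2 + 1 / (x + 2)\<^sup>2 + 1 / (x + 3)\<^sup>2)
      - 2 / ((x + 2) * (x + 3)) * (2 / ((x + 2) * (x + 3)) + 4) + 4 / (x + 1)\<^sup>2)"
    using nz by (simp add: divide_simps) algebra
  finally show ?case unfolding gap harm by simp
next
  case (Suc n)
  let ?N = "of_nat n :: complex"
  define B where "B = (x + 2 * ?N + 1) gchoose (n - 1)"
  define B' where "B' = (x + 2 * of_nat (Suc n) + 1) gchoose (Suc n - 1)"
  define P where "P = (x + 2 * ?N + 1) gchoose n"
  define D where "D = harm_gap n x"
  define H where "H = gharm 2 (2 * n + 1) x"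
  define u where "u = x + 2 * ?N + 2"
  define v where "v = x + 2 * ?N + 3"
  define A where "A = 4 * H - D * (D + 4 / ?N) + 4 / (x + 1)\<^sup>2"
  \<comment> \<open>The bracket for \<open>n + 1\<close>, with \<open>H\<close> and \<open>D\<close>
    advanced by their one-step increments.\<close>
  define A' where "A' = 4 * (H + 1 / u\<^sup>2 + 1 / v\<^sup>2)
    - (D + 2 / (u * v)) * (D + 2 / (u * v) + 4 / (?N + 1)) + 4 / (x + 1)\<^sup>2"
  have x1: "x + 1 \<noteq> 0" using Suc.prems[of 1] by simp
  have nz: "u \<noteq> 0" "v \<noteq> 0" "x + ?N + 3 \<noteq> 0"
    using Suc.prems[of "2 * n + 2"] Suc.prems[of "2 * n + 3"] Suc.prems[of "n + 3"] Suc.hyps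
    unfolding u_def v_def by (simp_all add: add_ac)
  have N: "?N \<noteq> 0" "?N + 1 \<noteq> 0"
    using Suc.hyps of_nat_neq_0[of n, where 'a = complex] by (simp_all add: add.commute)
  have IH: "weighted_sum n x = (x + 1) / 8 * B * A"
    using Suc unfolding B_def A_def D_def H_def by simp
  have rs: "recip_sum n x = P * (1 / (x + 1) - D / 2)"
    unfolding P_def D_def by (rule recip_sum_closed_form) (use Suc in auto)
  have step: "?N * (?N + 1) * (x + ?N + 3) * weighted_sum (Suc n) x
      = (?N + 1) * u * v * weighted_sum n x + ?N * (x + 1) * B
        + (x + 3 * ?N + 3) * (P - (x + 1) * recip_sum n x)"
    unfolding u_def v_def B_def P_def by (rule weighted_sum_Suc) (use Suc in auto)
  have PB: "?N * P = (x + ?N + 2) * B"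
    using gbinomial_mult_1[of "x + 2 * ?N + 1" "n - 1"] Suc.hyps
    unfolding P_def B_def by (simp add: of_nat_diff algebra_simps)
  have BB: "?N * (x + ?N + 3) * B' = u * v * B"
  proof -
    have "Suc (n - 1) = n" "x + 2 * ?N + 1 + 1 - of_nat (n - 1) = x + ?N + 3"
        "x + 2 * ?N + 1 + 1 = u" "x + 2 * ?N + 1 + 2 = v" "x + 2 * of_nat (Suc n) + 1 = v"
      using Suc.hyps unfolding u_def v_def by (simp_all add: of_nat_diff)
    then show ?thesis
      using gbinomial_ratio_step[of "n - 1" "x + 2 * ?N + 1"]
      unfolding B_def B'_def by (simp only: diff_Suc_1)
  qed
  have A_step: "(?N + 1) * ?N * u * v * (A' - A) = 8 * ?N\<^sup>2 + 4 * (x + 3 * ?N + 3) * (x + ?N + 2) * D"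
  proof -
    have v: "v = u + 1" unfolding u_def v_def by simp
    \<comment> \<open>Since \<open>1 / u - 1 / v = 1 / (u * v)\<close>, the squared increment of
      \<open>D\<close> absorbs the square of this difference, and only the mixed term
      remains.\<close>
    have sq: "1 / u\<^sup>2 + 1 / v\<^sup>2 - 1 / (u * v)\<^sup>2 = 2 / (u * v)"
      using nz unfolding v by (simp add: divide_simps) algebra
    have "A' - A = 4 * (1 / u\<^sup>2 + 1 / v\<^sup>2 - 1 / (u * v)\<^sup>2) - 4 * D / (u * v)
        - 8 / (u * v) / (?N + 1) + D * (4 / ?N - 4 / (?N + 1))"
      unfolding A'_def A_def by (simp only: divide_inverse power2_eq_square inverse_mult_distrib) (simp add: algebra_simps)
    also have "\<dots> = 8 / (u * v) - 4 * D / (u * v)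
        - 8 / (u * v) / (?N + 1) + D * (4 / ?N - 4 / (?N + 1))"
      unfolding sq by simp
    finally have "(?N + 1) * ?N * u * v * (A' - A)
        = 8 * ?N\<^sup>2 + 4 * D * (u * v - ?N * (?N + 1))"
      using nz N by (simp add: divide_simps) algebra
    \<comment> \<open>Here \<open>u\<close> and \<open>v\<close> exceed \<open>?N\<close> and
      \<open>?N + 1\<close> by the same amount \<open>x + ?N + 2\<close>. The factors match
      \<open>x + 3 * ?N + 3\<close> in the recurrence and \<open>x + ?N + 2\<close> in
      \<open>PB\<close>.\<close>
    also have "u * v - ?N * (?N + 1) = (x + 3 * ?N + 3) * (x + ?N + 2)"
      unfolding u_def v_def by algebra
    finally show ?thesis by (simp only: mult_ac)
  qed
  \<comment> \<open>The factor 8 clears the denominator of the closed form; the extra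
    \<open>?N\<close> allows \<open>P\<close> to be replaced by \<open>B\<close> through
    \<open>PB\<close>.\<close>
  have "8 * ?N * (?N * (?N + 1) * (x + ?N + 3) * weighted_sum (Suc n) x)
      = (x + 1) * B * ((?N + 1) * ?N * u * v * A)
        + 8 * ?N\<^sup>2 * (x + 1) * B + 4 * (x + 3 * ?N + 3) * (x + 1) * D * (?N * P)"
  proof -
    have rem: "P - (x + 1) * recip_sum n x = (x + 1) * P * D / 2"
      unfolding rs using x1 by (simp add: divide_simps) algebra
    show ?thesis unfolding step IH rem by (simp add: field_simps power2_eq_square)
  qed
  also have "\<dots> = (x + 1) * B * ((?N + 1) * ?N * u * v * A + (?N + 1) * ?N * u * v * (A' - A))"
    unfolding PB A_step by (simp add: algebra_simps)
  also have "\<dots> = (x + 1) * A' * (?N + 1) * ?N * (u * v * B)"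
    by (simp add: algebra_simps)
  also have "\<dots> = 8 * ?N * (?N * (?N + 1) * (x + ?N + 3) * ((x + 1) / 8 * B' * A'))"
    unfolding BB[symmetric] by simp
  finally have "weighted_sum (Suc n) x = (x + 1) / 8 * B' * A'"
    using N nz(3) by simp (simp add: mult_ac)
  moreover have "harm_gap (Suc n) x = D + 2 / (u * v)"
    using harm_gap_Suc nz unfolding D_def u_def v_def by blast
  moreover have "gharm 2 (2 * Suc n + 1) x = H + 1 / u\<^sup>2 + 1 / v\<^sup>2"
    unfolding H_def gharm_def u_def v_def by (simp add: add_ac)
  ultimately show ?case unfolding A'_def B'_def by (simp add: add.commute)
qed

section \<open>The identity with generalised binomials\<close>

theorem theorem5:
  fixes x :: complex and n :: nat
  assumes "n \<ge> 1"
    and "\<forall>k\<in>{1..2 * n + 1}. x + of_nat k \<noteq> 0"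
  shows "(\<Sum>k=0..n. ((2 * of_nat n - of_nat k) gchoose n) * ((x + of_nat k) gchoose k)
            * of_nat k * gharm 2 k x)
       = (x + 1) / 8 * ((x + 2 * of_nat n + 1) gchoose (n - 1)) *
           (4 * gharm 2 (2 * n + 1) x
            - (gharm 1 n (x / 2) - gharm 1 n ((x + 1) / 2))
              * (gharm 1 n (x / 2) - gharm 1 n ((x + 1) / 2) + 4 / of_nat n)
            + 4 / (x + 1) ^ 2)"
proof -
  have "((2 * of_nat n - of_nat k) gchoose n) = (of_nat ((2 * n - k) choose n) :: complex)"
    if "k \<le> n" for k
    using that by (simp add: binomial_gbinomial of_nat_diff)
  then have "(\<Sum>k=0..n. ((2 * of_nat n - of_nat k) gchoose n) * ((x + of_nat k) gchoose k)
      * of_nat k * gharm 2 k x) = weighted_sum n x"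
    unfolding weighted_sum_def atMost_atLeast0 by (intro sum.cong) auto
  also note weighted_sum_closed_form[OF assms(1), of x]
  finally show ?thesis using assms(2) unfolding harm_gap_def by auto
qed

end
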